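(* (Validity of the syllogisms of Figure III.) Let $S,M,P$ be three logically independent events. Then the following probabilistic inferences are strictly valid ($\models_s$): \begin{itemize} \item (Darapti) $(p(P|M)=1,\ p(S|M)=1,\ p(M|(S\vee M))>0)\ \models_s\ p(P|S)>0$; \item (Datisi) $(p(P|M)=1,\ p(S|M)>0,\ p(M|(S\vee M))>0)\ \models_s\ p(P|S)>0$; \item (Disamis) $(p(P|M)>0,\ p(S|M)=1,\ p(M|(S\vee M))>0)\ \models_s\ p(P|S)>0$; \item (Felapton) $(p(P|M)=0,\ p(S|M)=1,\ p(M|(S\vee M))>0)\ \models_s\ p(\overline{P}|S)>0$; \item (Ferison) $(p(P|M)=0,\ p(S|M)>0,\ p(M|(S\vee M))>0)\ \models_s\ p(\overline{P}|S)>0$; \item (Bocardo) $(p(\overline{P}|M)>0,\ p(S|M)=1,\ p(M|(S\vee M))>0)\ \models_s\ p(\overline{P}|S)>0$. \end{itemize}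
   Context: Events are elements of a Boolean algebra (e.g. subsets of a set $\Omega$), identified with their $\{0,1\}$-valued indicators; $\overline{E}$ is the negation of $E$ and juxtaposition or $\wedge$ is conjunction. Three events are logically independent if all $8$ conjunctions obtained by choosing each of them or its negation are different from the impossible event $\bot$. For events $E,H$ with $H\ne\bot$, the conditional event $E|H$ is true if $EH$ is true, false if $\overline{E}H$ is true, and void if $H$ is false. Coherence: an assessment $\mathcal P=(p_1,\dots,p_n)\in\mathbb R^n$ on $\mathcal F=(E_1|H_1,\dots,E_n|H_n)$ is coherent if for every nonempty $J\subseteq\{1,\dots,n\}$ and all real numbers $s_j$ ($j\in J$), the random gain $G=\sum_{j\in J}s_jH_j(E_j-p_j)$, restricted to $\bigvee_{j\in J}H_j$ (i.e. considering only its values when at least one $H_j$, $j\in J$, is true), has minimum $\le 0$ and maximum $\ge 0$. An imprecise assessment on $\mathcal F$ is a set $\mathcal I\subseteq[0,1]^n$; it is g-coherent if it contains at least one coherent assessment. The set $\Sigma$ of coherent extensions of $\mathcal I$ to a further conditional event $E_{n+1}|H_{n+1}$ is the set of all $z\in[0,1]$ such that, for some coherent $\mathcal P\in\mathcal I$, the assessment $(\mathcal P,z)$ on $(\mathcal F,E_{n+1}|H_{n+1})$ is coherent. For a g-coherent $\mathcal I$ on $\mathcal F$ and a nonempty $\mathcal I'\subseteq[0,1]$, the inference "from $\mathcal I$ on $\mathcal F$ infer $\mathcal I'$ on $E_{n+1}|H_{n+1}$" is strictly valid ($\models_s$) if $\Sigma=\mathcal I'$. A list of constraints $p(E_i|H_i)\in\mathcal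 I_i$ stands for the imprecise assessment $\mathcal I_1\times\cdots\times\mathcal I_n$; all probabilities range in $[0,1]$, so "$=1$" is $\{1\}$, "$=0$" is $\{0\}$, and "$>0$" is $(0,1]$. A conclusion $p(\overline{P}|S)\in\mathcal I'$ is an assessment on $\overline{P}|S$. *)

theory Defs
  imports Complex_Main
begin

definition logically_independent3 ::
  "'a::boolean_algebra \<Rightarrow> 'a \<Rightarrow> 'a \<Rightarrow> bool" where
  "logically_independent3 A B C \<longleftrightarrow>
     (\<forall>A'\<in>{A, - A}. \<forall>B'\<in>{B, - B}. \<forall>C'\<in>{C, - C}. inf A' (inf B' C') \<noteq> bot)"

text \<open>\<open>E given H\<close> is the conditional event $E|H$; the requirement that $H$ is not the
  impossible event is part of \<open>coherent\<close> below.\<close>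

datatype 'a cond_event = Given (antecedent: 'a) (hypothesis: 'a)  (infix \<open>given\<close> 60)

definition literal :: "bool \<Rightarrow> 'a::boolean_algebra \<Rightarrow> 'a" where
  "literal b E = (if b then E else - E)"

text \<open>In an abstract Boolean algebra the points at which the random gain is evaluated are the
  constituents, that is, the possible joint truth values of the events involved:
  \<open>e i\<close> and \<open>h i\<close> are the truth values of $E_i$ and $H_i$ (indices start at 0).\<close>

definition constituent ::
  "'a::boolean_algebra cond_event list \<Rightarrow> (nat \<Rightarrow> bool) \<Rightarrow> (nat \<Rightarrow> bool) \<Rightarrow> 'a" where
  "constituent F e h =
     foldr inf (map (\<lambda>i. inf (literal (e i) (antecedent (F ! i)))
                             (literal (h i) (hypothesis (F ! i)))) [0..<length F]) top"

definition gain ::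
  "real list \<Rightarrow> nat set \<Rightarrow> (nat \<Rightarrow> real) \<Rightarrow> (nat \<Rightarrow> bool) \<Rightarrow> (nat \<Rightarrow> bool) \<Rightarrow> real" where
  "gain p J s e h = (\<Sum>j\<in>J. s j * of_bool (h j) * (of_bool (e j) - p ! j))"

definition gain_values ::
  "'a::boolean_algebra cond_event list \<Rightarrow> real list \<Rightarrow> nat set \<Rightarrow> (nat \<Rightarrow> real) \<Rightarrow> real set" where
  "gain_values F p J s =
     {gain p J s e h | e h. constituent F e h \<noteq> bot \<and> (\<exists>j\<in>J. h j)}"

definition coherent :: "'a::boolean_algebra cond_event list \<Rightarrow> real list \<Rightarrow> bool" where
  "coherent F p \<longleftrightarrow>
     length p = length F \<and> (\<forall>C\<in>set F. hypothesis C \<noteq> bot) \<and>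
     (\<forall>J s. J \<noteq> {} \<longrightarrow> J \<subseteq> {..<length F} \<longrightarrow>
        Min (gain_values F p J s) \<le> 0 \<and> Max (gain_values F p J s) \<ge> 0)"

definition imprecise_assessment :: "'a cond_event list \<Rightarrow> real list set \<Rightarrow> bool" where
  "imprecise_assessment F I \<longleftrightarrow> (\<forall>p\<in>I. length p = length F \<and> set p \<subseteq> {0..1})"

definition g_coherent :: "'a::boolean_algebra cond_event list \<Rightarrow> real list set \<Rightarrow> bool" where
  "g_coherent F I \<longleftrightarrow> imprecise_assessment F I \<and> (\<exists>p\<in>I. coherent F p)"

definition coherent_extensions ::
  "'a::boolean_algebra cond_event list \<Rightarrow> real list set \<Rightarrow> 'a cond_event \<Rightarrow> real set" where
  "coherent_extensions F I C =
     {z \<in> {0..1}. \<exists>p\<in>I. coherent F p \<and> coherent (F @ [C]) (p @ [z])}"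

definition strictly_valid ::
  "'a::boolean_algebra cond_event list \<Rightarrow> real list set \<Rightarrow> 'a cond_event \<Rightarrow> real set \<Rightarrow> bool" where
  "strictly_valid F I C I' \<longleftrightarrow>
     g_coherent F I \<and> I' \<noteq> {} \<and> I' \<subseteq> {0..1} \<and> coherent_extensions F I C = I'"

text \<open>A list of premises \<open>(E given H, A)\<close>, read $p(E|H) \in A$, stands for the product of the
  constraint sets (\<open>listset\<close>).\<close>

definition entails_s ::
  "('a::boolean_algebra cond_event \<times> real set) list \<Rightarrow> 'a cond_event \<times> real set \<Rightarrow> bool"
  (infix \<open>\<Turnstile>\<^sub>s\<close> 50) where
  "\<Gamma> \<Turnstile>\<^sub>s c \<longleftrightarrow> strictly_valid (map fst \<Gamma>) (listset (map snd \<Gamma>)) (fst c) (snd c)"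

text \<open>The set of gain values is finite, so \<open>Min\<close> and \<open>Max\<close> are meaningful, and for events that
  are subsets of a sample space it is the pointwise notion.\<close>

lemma finite_gain_values:
  assumes "finite J"
  shows "finite (gain_values F p J s)"
proof -
  have "gain_values F p J s \<subseteq>
      (\<lambda>(A, B). gain p J s (\<lambda>j. j \<in> A) (\<lambda>j. j \<in> B)) ` (Pow J \<times> Pow J)"
  proof
    fix x assume "x \<in> gain_values F p J s"
    then obtain e h where x: "x = gain p J s e h"
      unfolding gain_values_def by blast
    have "x = gain p J s (\<lambda>j. j \<in> {j\<in>J. e j}) (\<lambda>j. j \<in> {j\<in>J. h j})"
      unfolding x gain_def by (rule sum.cong) auto
    then show "x \<in> (\<lambda>(A, B). gain p J s (\<lambda>j. j \<in> A) (\<lambda>j. j \<in> B)) ` (Pow J \<times> Pow J)"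
      by (intro image_eqI[where x = "({j\<in>J. e j}, {j\<in>J. h j})"]) auto
  qed
  then show ?thesis
    by (rule finite_subset) (use assms in auto)
qed

lemma in_constituent_set:
  fixes F :: "'w set cond_event list"
  shows "w \<in> constituent F e h \<longleftrightarrow>
    (\<forall>i<length F. (w \<in> antecedent (F ! i) \<longleftrightarrow> e i) \<and> (w \<in> hypothesis (F ! i) \<longleftrightarrow> h i))"
proof -
  have *: "w \<in> foldr inf As top \<longleftrightarrow> (\<forall>A\<in>set As. w \<in> A)" for As :: "'w set list"
    by (induction As) auto
  show ?thesis
    unfolding constituent_def * literal_def by auto
qed

lemma gain_values_set:
  fixes F :: "'w set cond_event list"
  assumes "J \<subseteq> {..<length F}"
  shows "gain_values F p J s =
    (\<lambda>w. \<Sum>j\<in>J. s j * of_bool (w \<in> hypothesis (F ! j)) * (of_bool (w \<in> antecedent (F ! j)) - p ! j))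
      ` (\<Union>j\<in>J. hypothesis (F ! j))"
    (is "_ = ?g ` ?U")
proof (intro equalityI subsetI)
  fix x assume "x \<in> gain_values F p J s"
  then obtain e h w where x: "x = gain p J s e h" and w: "w \<in> constituent F e h"
    and ex: "\<exists>j\<in>J. h j"
    unfolding gain_values_def by blast
  have eq: "(w \<in> antecedent (F ! j) \<longleftrightarrow> e j) \<and> (w \<in> hypothesis (F ! j) \<longleftrightarrow> h j)" if "j \<in> J" for j
    using w assms that unfolding in_constituent_set by blast
  have "x = ?g w"
    unfolding x gain_def by (rule sum.cong) (use eq in auto)
  moreover have "w \<in> ?U" using ex eq by blast
  ultimately show "x \<in> ?g ` ?U" by blast
next
  fix x assume "x \<in> ?g ` ?U"
  then obtain w where x: "x = ?g w" and w: "w \<in> ?U" by blast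
  let ?e = "\<lambda>i. w \<in> antecedent (F ! i)" and ?h = "\<lambda>i. w \<in> hypothesis (F ! i)"
  have "w \<in> constituent F ?e ?h" by (simp add: in_constituent_set)
  then have "constituent F ?e ?h \<noteq> bot" by auto
  moreover have "x = gain p J s ?e ?h" unfolding x gain_def ..
  ultimately show "x \<in> gain_values F p J s"
    unfolding gain_values_def using w by blast
qed

end

theory Submission
  imports Defs
begin

text \<open>
  Both directions rest on the betting reading of coherence.

  The conclusion must be positive: the indicators satisfy $PS \ge M(P+S-1)$. So if
  $p(P|M)=x$, $p(S|M)=y$, $p(M|S\vee M)=t$ with $x+y>1$ and $t>0$, while $p(P|S)=z\le 0$,
  then the bets with stakes $-1$, $-1$, $-(x+y-1)$, $1$ bring at least $(x+y-1)t>0$ in every case,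
  which contradicts coherence (\<open>positive_conclusion\<close>). In every mood with an affirmative
  conclusion one of $x$, $y$ is 1 and the other is positive, so $x+y>1$.

  Every positive value occurs: for $0<z\le 1$, put mass $z$ on $SMP$ and mass $1-z$ on
  $S\overline{M}\,\overline{P}$. This probability gives all conditioning events positive mass, so its
  conditional probabilities $1$, $1$, $z$ and $z$ are coherent, because the expected gain vanishes
  (\<open>coherent_from_weights\<close>). These values satisfy the premises of all moods with
  affirmative conclusion at once.

  The moods with a negative conclusion are the same inferences for $\overline{P}$, since assessing
  $E|H$ at $x$ amounts to assessing $\overline{E}|H$ at $1-x$ (\<open>entails_s_negate\<close>).
\<close>

section \<open>Gains at deciding events\<close>

text \<open>A possible event that settles the truth value of every event in the list takes the place of a
  sample point: \<open>\<le>\<close> then plays the role of membership and commutes with the Boolean operations.\<close>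

definition decides :: "'a::boolean_algebra \<Rightarrow> 'a \<Rightarrow> bool" where
  "decides c E \<longleftrightarrow> c \<le> E \<or> c \<le> - E"

definition case_of :: "'a::boolean_algebra cond_event list \<Rightarrow> 'a \<Rightarrow> bool" where
  "case_of F c \<longleftrightarrow> c \<noteq> bot \<and>
     (\<forall>C\<in>set F. decides c (antecedent C) \<and> decides c (hypothesis C))"

definition bet_at :: "'a::boolean_algebra \<Rightarrow> 'a cond_event \<Rightarrow> real \<Rightarrow> real" where
  "bet_at c C x = of_bool (c \<le> hypothesis C) * (of_bool (c \<le> antecedent C) - x)"

lemma le_compl_iff_not_le:
  fixes c E :: "'a::boolean_algebra"
  assumes "c \<noteq> bot" "decides c E"
  shows "c \<le> - E \<longleftrightarrow> \<not> c \<le> E"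
  using assms unfolding decides_def
  by (metis inf.bounded_iff inf_compl_bot le_bot)

lemma decides_compl: "decides c (- E) \<longleftrightarrow> decides c E"
  by (auto simp: decides_def)

lemma le_sup_iff_le:
  fixes c :: "'a::boolean_algebra"
  assumes "decides c A"
  shows "c \<le> sup A B \<longleftrightarrow> c \<le> A \<or> c \<le> B"
proof -
  have "c \<le> B" if "c \<le> - A" "c \<le> sup A B"
  proof -
    have "c \<le> inf (- A) (sup A B)" using that by simp
    also have "\<dots> \<le> B" by (simp add: inf_sup_distrib1)
    finally show ?thesis .
  qed
  then show ?thesis
    using assms unfolding decides_def by (auto intro: le_supI1 le_supI2)
qed

lemma le_constituent_iff:
  "c \<le> constituent F e h \<longleftrightarrow> (\<forall>i<length F.
     c \<le> literal (e i) (antecedent (F ! i)) \<and> c \<le> literal (h i) (hypothesis (F ! i)))"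
proof -
  have "c \<le> foldr inf As top \<longleftrightarrow> (\<forall>A\<in>set As. c \<le> A)" for As :: "'a list"
    by (induction As) auto
  then show ?thesis
    unfolding constituent_def by auto
qed

lemma le_literal:
  fixes c E :: "'a::boolean_algebra"
  assumes "c \<noteq> bot" "c \<le> literal b E"
  shows "decides c E" "b \<longleftrightarrow> c \<le> E"
proof -
  show "decides c E"
    using assms(2) by (auto simp: decides_def literal_def split: if_splits)
  then show "b \<longleftrightarrow> c \<le> E"
    using assms le_compl_iff_not_le[of c E] by (auto simp: literal_def split: if_splits)
qed

lemma gain_values_cases:
  assumes "J \<subseteq> {..<length F}"
  shows "gain_values F p J s =
    (\<lambda>c. \<Sum>j\<in>J. s j * bet_at c (F ! j) (p ! j)) ` {c. case_of F c \<and> (\<exists>j\<in>J. c \<le> hypothesis (F ! j))}"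
    (is "_ = ?g ` ?U")
proof (intro equalityI subsetI)
  fix x assume "x \<in> gain_values F p J s"
  then obtain e h where x: "x = gain p J s e h" and nb: "constituent F e h \<noteq> bot"
    and ex: "\<exists>j\<in>J. h j"
    unfolding gain_values_def by blast
  let ?c = "constituent F e h"
  have lit: "?c \<le> literal (e i) (antecedent (F ! i))" "?c \<le> literal (h i) (hypothesis (F ! i))"
    if "i < length F" for i
    using le_constituent_iff[of ?c F e h] that by auto
  have val: "e i \<longleftrightarrow> ?c \<le> antecedent (F ! i)" "h i \<longleftrightarrow> ?c \<le> hypothesis (F ! i)"
    if "i < length F" for i
    using le_literal(2)[OF nb] lit[OF that] by blast+
  have "case_of F ?c"
    unfolding case_of_def using nb le_literal(1)[OF nb] lit by (metis in_set_conv_nth)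
  moreover have "\<exists>j\<in>J. ?c \<le> hypothesis (F ! j)"
    using ex val assms by blast
  moreover have "x = ?g ?c"
    unfolding x gain_def bet_at_def using assms by (intro sum.cong) (auto simp: val)
  ultimately show "x \<in> ?g ` ?U" by blast
next
  fix x assume "x \<in> ?g ` ?U"
  then obtain c where x: "x = ?g c" and c: "case_of F c" and ex: "\<exists>j\<in>J. c \<le> hypothesis (F ! j)"
    by blast
  let ?e = "\<lambda>i. c \<le> antecedent (F ! i)" and ?h = "\<lambda>i. c \<le> hypothesis (F ! i)"
  have "c \<le> constituent F ?e ?h"
    using c unfolding le_constituent_iff case_of_def decides_def literal_def by auto
  then have "constituent F ?e ?h \<noteq> bot"
    using c le_bot unfolding case_of_def by metis
  moreover have "x = gain p J s ?e ?h"
    unfolding x gain_def bet_at_def by (simp add: mult.assoc)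
  ultimately show "x \<in> gain_values F p J s"
    unfolding gain_values_def using ex by blast
qed

section \<open>Two criteria for coherence\<close>

text \<open>Conditional probabilities of a finitely supported probability are coherent whenever all
  conditioning events have positive mass: the weighted sum of the gains is zero, and only cases in
  which some bet of \<open>J\<close> is not called off contribute, so these gains cannot all have
  the same strict sign.\<close>

lemma coherent_from_weights:
  fixes F :: "'a::boolean_algebra cond_event list" and w :: "'a \<Rightarrow> real"
  assumes fin: "finite K" and K: "\<And>c. c \<in> K \<Longrightarrow> case_of F c" and w: "\<And>c. c \<in> K \<Longrightarrow> 0 \<le> w c"
    and len: "length p = length F"
    and pos: "\<And>i. i < length F \<Longrightarrow> 0 < (\<Sum>c\<in>K. w c * of_bool (c \<le> hypothesis (F ! i)))"
    and fair: "\<And>i. i < length F \<Longrightarrow> (\<Sum>c\<in>K. w c * bet_at c (F ! i) (p ! i)) = 0"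
  shows "coherent F p"
proof -
  have hyp: "\<exists>c\<in>K. 0 < w c \<and> c \<le> hypothesis (F ! i)" if "i < length F" for i
  proof (rule ccontr)
    assume "\<not> ?thesis"
    then have "(\<Sum>c\<in>K. w c * of_bool (c \<le> hypothesis (F ! i))) \<le> 0"
      by (intro sum_nonpos) (auto simp: not_less)
    with pos[OF that] show False by simp
  qed
  have "hypothesis C \<noteq> bot" if "C \<in> set F" for C
    using that hyp K le_bot unfolding case_of_def by (metis in_set_conv_nth)
  moreover have "Min (gain_values F p J s) \<le> 0 \<and> 0 \<le> Max (gain_values F p J s)"
    if J: "J \<noteq> {}" "J \<subseteq> {..<length F}" for J s
  proof -
    let ?g = "\<lambda>c. \<Sum>j\<in>J. s j * bet_at c (F ! j) (p ! j)"
    let ?L = "{c\<in>K. \<exists>j\<in>J. c \<le> hypothesis (F ! j)}"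
    have finV: "finite (gain_values F p J s)"
      using J finite_gain_values[of J] finite_subset[OF _ finite_lessThan] by blast
    have val: "?g c \<in> gain_values F p J s" if "c \<in> ?L" for c
      unfolding gain_values_cases[OF J(2)] using that K by blast
    have "(\<Sum>c\<in>?L. w c * ?g c) = (\<Sum>c\<in>K. w c * ?g c)"
      using fin by (intro sum.mono_neutral_left) (auto simp: bet_at_def)
    also have "\<dots> = (\<Sum>j\<in>J. s j * (\<Sum>c\<in>K. w c * bet_at c (F ! j) (p ! j)))"
      unfolding sum_distrib_left by (subst sum.swap) (simp add: mult.left_commute)
    also have "\<dots> = 0"
      using J fair by (intro sum.neutral) auto
    finally have zero: "(\<Sum>c\<in>?L. w c * ?g c) = 0" .
    obtain b where b: "b \<in> ?L" "0 < w b"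
      using J hyp by blast
    have finL: "finite ?L" using fin by simp
    have "\<exists>c\<in>?L. ?g c \<le> 0"
    proof (rule ccontr)
      assume "\<not> ?thesis"
      then have g: "0 < ?g c" if "c \<in> ?L" for c
        using that by force
      have "0 < (\<Sum>c\<in>?L. w c * ?g c)"
        by (rule sum_pos2[OF finL b(1)])
          (use b g w in \<open>auto intro!: mult_pos_pos mult_nonneg_nonneg less_imp_le[OF g]\<close>)
      with zero show False by simp
    qed
    moreover have "\<exists>c\<in>?L. 0 \<le> ?g c"
    proof (rule ccontr)
      assume "\<not> ?thesis"
      then have g: "0 < - ?g c" if "c \<in> ?L" for c
        using that by force
      have "0 < (\<Sum>c\<in>?L. w c * - ?g c)"
        by (rule sum_pos2[OF finL b(1)])
          (use b g w in \<open>auto intro!: mult_pos_pos mult_nonneg_nonneg less_imp_le[OF g] simp del: mult_minus_right\<close>)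
      with zero show False by (simp add: sum_negf)
    qed
    ultimately show ?thesis
      using val finV by (meson Min_le Max_ge order_trans)
  qed
  ultimately show ?thesis
    unfolding coherent_def using len by blast
qed

text \<open>The least gain is attained, since a possible conditioning event refines to a case that makes
  it true.\<close>

lemma coherent_no_sure_gain:
  assumes coh: "coherent F p" and J: "J \<noteq> {}" "J \<subseteq> {..<length F}"
  shows "\<exists>c. case_of F c \<and> (\<exists>j\<in>J. c \<le> hypothesis (F ! j)) \<and>
    (\<Sum>j\<in>J. s j * bet_at c (F ! j) (p ! j)) \<le> 0"
proof -
  have fin: "finite (gain_values F p J s)"
    using J finite_gain_values[of J] finite_subset[OF _ finite_lessThan] by blast
  have "gain_values F p J s \<noteq> {}"
  proof -
    obtain j where j: "j \<in> J" using J by blast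
    then have "hypothesis (F ! j) \<noteq> bot"
      using coh J unfolding coherent_def by (auto simp: subset_iff)
    moreover
    \<comment> \<open>Meet the event with each \<open>E\<close> in turn or with \<open>- E\<close>; at least one choice leaves it possible.\<close>
    have "\<exists>c. c \<noteq> bot \<and> c \<le> a \<and> (\<forall>E\<in>set Es. decides c E)" if "a \<noteq> bot" for a and Es :: "'a list"
      using that
    proof (induction Es arbitrary: a)
      case Nil
      then show ?case by auto
    next
      case (Cons E Es)
      have "sup (inf a E) (inf a (- E)) = a"
        by (simp add: inf_sup_distrib1[symmetric])
      then have "inf a E \<noteq> bot \<or> inf a (- E) \<noteq> bot"
        using Cons.prems by force
      then obtain E' where E': "E' = E \<or> E' = - E" "inf a E' \<noteq> bot" by blast
      from Cons.IH[OF E'(2)] obtain c where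
        "c \<noteq> bot" "c \<le> inf a E'" "\<forall>E\<in>set Es. decides c E" by blast
      then show ?case
        using E'(1) by (intro exI[of _ c]) (auto simp: decides_def)
    qed
    ultimately obtain c where "c \<noteq> bot" "c \<le> hypothesis (F ! j)"
      "\<forall>E\<in>set (map antecedent F @ map hypothesis F). decides c E" by blast
    then have "case_of F c" "c \<le> hypothesis (F ! j)" by (auto simp: case_of_def)
    with j show ?thesis
      unfolding gain_values_cases[OF J(2)] by blast
  qed
  then have "Min (gain_values F p J s) \<in> gain_values F p J s"
    using fin by simp
  moreover have "Min (gain_values F p J s) \<le> 0"
    using coh J unfolding coherent_def by blast
  ultimately show ?thesis
    unfolding gain_values_cases[OF J(2)] by (smt (verit) image_iff mem_Collect_eq)
qed

section \<open>Negating an event\<close>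

lemma bet_at_negate:
  assumes "c \<noteq> bot" "decides c E"
  shows "bet_at c (- E given H) (1 - x) = - bet_at c (E given H) x"
  using le_compl_iff_not_le[OF assms] by (simp add: bet_at_def of_bool_def)

lemma case_of_negate: "case_of ((- E given H) # F) c \<longleftrightarrow> case_of ((E given H) # F) c"
  by (simp add: case_of_def decides_compl)

text \<open>Buying \<open>- E\<close> is selling \<open>E\<close>, so the negation is absorbed by reversing the stake. Coherence
  quantifies over all stakes and therefore does not notice it.\<close>

lemma gain_values_negate:
  fixes s :: "nat \<Rightarrow> real"
  assumes J: "J \<subseteq> {..<Suc (length F)}"
  shows "gain_values ((- E given H) # F) ((1 - x) # p) J s =
    gain_values ((E given H) # F) (x # p) J (s(0 := - s 0))"
proof -
  have hyp: "hypothesis (((- E given H) # F) ! j) = hypothesis (((E given H) # F) ! j)" for j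
    by (cases j) auto
  have "(\<Sum>j\<in>J. s j * bet_at c (((- E given H) # F) ! j) (((1 - x) # p) ! j)) =
      (\<Sum>j\<in>J. (s(0 := - s 0)) j * bet_at c (((E given H) # F) ! j) ((x # p) ! j))"
    if "case_of ((E given H) # F) c" for c
  proof (rule sum.cong[OF refl])
    fix j
    show "s j * bet_at c (((- E given H) # F) ! j) (((1 - x) # p) ! j) =
        (s(0 := - s 0)) j * bet_at c (((E given H) # F) ! j) ((x # p) ! j)"
      using that by (cases j) (auto simp: case_of_def bet_at_negate)
  qed
  then show ?thesis
    using J by (simp add: gain_values_cases case_of_negate hyp cong: image_cong_simp conj_cong)
qed

lemma coherent_negate:
  "coherent ((- E given H) # F) ((1 - x) # p) \<longleftrightarrow> coherent ((E given H) # F) (x # p)"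
proof -
  have imp: "coherent ((E given H) # F) (x # p)"
    if coh: "coherent ((- E given H) # F) ((1 - x) # p)" for E x
    unfolding coherent_def
  proof (intro conjI allI impI)
    fix J and s :: "nat \<Rightarrow> real"
    assume J: "J \<noteq> {}" "J \<subseteq> {..<length ((E given H) # F)}"
    let ?s = "s(0 := - s 0)"
    have "gain_values ((E given H) # F) (x # p) J s =
        gain_values ((- E given H) # F) ((1 - x) # p) J ?s"
      using J gain_values_negate[of J F E H x p ?s] by simp
    then show "Min (gain_values ((E given H) # F) (x # p) J s) \<le> 0"
      "0 \<le> Max (gain_values ((E given H) # F) (x # p) J s)"
      using coh J unfolding coherent_def by auto
  qed (use coh in \<open>auto simp: coherent_def\<close>)
  show ?thesis
    using imp[of E x] imp[of "- E" "1 - x"] by auto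
qed

lemma entails_s_negate:
  assumes "(- E given H, (\<lambda>x. 1 - x) ` A) # \<Gamma> \<Turnstile>\<^sub>s c"
  shows "(E given H, A) # \<Gamma> \<Turnstile>\<^sub>s c"
proof -
  let ?F = "map fst \<Gamma>" and ?I = "listset (map snd \<Gamma>)"
  have bex: "(\<exists>p\<in>set_Cons B ?I. Q p) \<longleftrightarrow> (\<exists>x\<in>B. \<exists>q\<in>?I. Q (x # q))"
    and ball: "(\<forall>p\<in>set_Cons B ?I. Q p) \<longleftrightarrow> (\<forall>x\<in>B. \<forall>q\<in>?I. Q (x # q))" for B Q
    by (auto simp: set_Cons_def)
  have ext: "coherent_extensions ((- E given H) # ?F) (set_Cons ((\<lambda>x. 1 - x) ` A) ?I) C =
      coherent_extensions ((E given H) # ?F) (set_Cons A ?I) C" for C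
    by (simp add: coherent_extensions_def bex coherent_negate)
  have gcoh: "g_coherent ((- E given H) # ?F) (set_Cons ((\<lambda>x. 1 - x) ` A) ?I) \<longleftrightarrow>
      g_coherent ((E given H) # ?F) (set_Cons A ?I)"
    by (simp add: g_coherent_def imprecise_assessment_def bex ball coherent_negate conj_ac)
  show ?thesis
    using assms gcoh by (auto simp: entails_s_def strictly_valid_def ext)
qed

section \<open>Syllogisms of Figure III\<close>

lemma logically_independent3_compl:
  "logically_independent3 S M P \<Longrightarrow> logically_independent3 S M (- P)"
  unfolding logically_independent3_def by auto

text \<open>The system of bets below pays $SP - M(P-x) - M(S-y) - (x+y-1)(M-t) - zS$ when $S\vee M$ is
  true, which for $z \le 0$ is at least $(x+y-1)t$, because $SP \ge M(S+P-1)$.\<close>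

lemma positive_conclusion:
  fixes S M P :: "'a::boolean_algebra"
  assumes coh: "coherent [P given M, S given M, M given sup S M, P given S] [x, y, t, z]"
    and xy: "x + y > 1" and t: "t > 0"
  shows "z > 0"
proof (rule ccontr)
  assume z: "\<not> z > 0"
  let ?F = "[P given M, S given M, M given sup S M, P given S]"
  define s where "s = (!) [- 1, - 1, - (x + y - 1), 1 :: real]"
  have "{..<4} \<noteq> ({}::nat set)" "{..<4} \<subseteq> {..<length ?F}" by (auto simp: lessThan_empty_iff)
  from coherent_no_sure_gain[OF coh this, of s] obtain c where
    c: "case_of ?F c" and live: "\<exists>j<4. c \<le> hypothesis (?F ! j)"
    and le: "(\<Sum>j<4. s j * bet_at c (?F ! j) ([x, y, t, z] ! j)) \<le> 0"
    by auto
  have sup: "c \<le> sup S M \<longleftrightarrow> c \<le> S \<or> c \<le> M"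
    using c by (intro le_sup_iff_le) (auto simp: case_of_def)
  have SM: "c \<le> S \<or> c \<le> M"
    using live sup by (auto simp: eval_nat_numeral less_Suc_eq)
  have "0 < (x + y - 1) * t"
    using xy t by simp
  then have "0 < (\<Sum>j<4. s j * bet_at c (?F ! j) ([x, y, t, z] ! j))"
    using SM z by (auto simp: eval_nat_numeral s_def bet_at_def sup of_bool_def algebra_simps)
  with le show False by simp
qed

text \<open>Even certainty of both premises given \<open>M\<close> leaves every positive value open: all of \<open>M\<close> lies in
  $SMP$, but the part of \<open>S\<close> outside \<open>M\<close>, of mass \<open>1 - z\<close>, can avoid \<open>P\<close>.\<close>

lemma coherent_witness:
  fixes S M P :: "'a::boolean_algebra"
  assumes ind: "logically_independent3 S M P" and z: "0 < z" "z \<le> 1"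
  shows "coherent [P given M, S given M, M given sup S M] [1, 1, z]"
    and "coherent [P given M, S given M, M given sup S M, P given S] [1, 1, z, z]"
proof -
  define a where "a = inf S (inf M P)"
  define b where "b = inf S (inf (- M) (- P))"
  have nb: "a \<noteq> bot" "b \<noteq> bot"
    using ind unfolding logically_independent3_def a_def b_def by auto
  have a: "a \<le> S" "a \<le> M" "a \<le> P" "a \<le> sup S M"
    by (auto simp: a_def le_infI1 le_infI2 le_supI1)
  have b: "b \<le> S" "b \<le> - M" "b \<le> - P" "b \<le> sup S M"
    by (auto simp: b_def le_infI1 le_infI2 le_supI1)
  have nle: "\<not> b \<le> M" "\<not> b \<le> P"
    using b nb le_compl_iff_not_le[of b] by (auto simp: decides_def)
  have ab: "a \<noteq> b" using a nle by auto
  let ?w = "\<lambda>c. if c = a then z else 1 - z"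
  show "coherent [P given M, S given M, M given sup S M, P given S] [1, 1, z, z]"
    by (rule coherent_from_weights[where K = "{a, b}" and w = ?w])
      (use nb a b nle ab z in
        \<open>auto simp: case_of_def decides_def bet_at_def nth_Cons algebra_simps split: nat.splits\<close>)
  show "coherent [P given M, S given M, M given sup S M] [1, 1, z]"
    by (rule coherent_from_weights[where K = "{a, b}" and w = ?w])
      (use nb a b nle ab z in
        \<open>auto simp: case_of_def decides_def bet_at_def nth_Cons algebra_simps split: nat.splits\<close>)
qed

text \<open>Widening \<open>A\<close> or \<open>B\<close> beyond \<open>{1}\<close> adds no conclusion: the witness above already produces every
  positive value from certain premises, and \<open>x + y > 1\<close> persists as long as one of the two stays
  certain.\<close>

lemma figure_III:
  fixes S M P :: "'a::boolean_algebra"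
  assumes ind: "logically_independent3 S M P"
    and A: "1 \<in> A" "A \<subseteq> {0<..1}" and B: "1 \<in> B" "B \<subseteq> {0<..1}" and one: "A = {1} \<or> B = {1}"
  shows "[(P given M, A), (S given M, B), (M given sup S M, {0<..1})] \<Turnstile>\<^sub>s (P given S, {0<..1})"
proof -
  let ?F = "[P given M, S given M, M given sup S M]"
  let ?I = "listset [A, B, {0<..1::real}]"
  have memb: "p \<in> ?I \<longleftrightarrow> (\<exists>x y t. p = [x, y, t] \<and> x \<in> A \<and> y \<in> B \<and> 0 < t \<and> t \<le> 1)" for p
    by (auto simp: set_Cons_def)
  have "imprecise_assessment ?F ?I"
    unfolding imprecise_assessment_def
  proof
    fix p assume "p \<in> ?I"
    then obtain x y t where "p = [x, y, t]" "x \<in> A" "y \<in> B" "0 < t" "t \<le> 1"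
      unfolding memb by blast
    then show "length p = length ?F \<and> set p \<subseteq> {0..1}"
      using A(2) B(2) by force
  qed
  moreover have "\<exists>p\<in>?I. coherent ?F p"
  proof
    show "coherent ?F [1, 1, 1]"
      using coherent_witness(1)[OF ind, of 1] by simp
    show "[1, 1, 1] \<in> ?I"
      using A B unfolding memb by simp
  qed
  moreover have "coherent_extensions ?F ?I (P given S) = {0<..1}"
  proof (intro equalityI subsetI)
    fix z assume "z \<in> coherent_extensions ?F ?I (P given S)"
    then obtain p where z: "z \<le> 1" and p: "p \<in> ?I" "coherent (?F @ [P given S]) (p @ [z])"
      unfolding coherent_extensions_def by auto
    from p(1) obtain x y t where p_eq: "p = [x, y, t]" and xyt: "x \<in> A" "y \<in> B" "0 < t"
      unfolding memb by blast
    have "x + y > 1"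
      using xyt A B one by auto
    moreover have "coherent [P given M, S given M, M given sup S M, P given S] [x, y, t, z]"
      using p(2) by (simp add: p_eq)
    ultimately have "z > 0"
      using positive_conclusion xyt(3) by blast
    with z show "z \<in> {0<..1}" by simp
  next
    fix z :: real assume "z \<in> {0<..1}"
    then have z: "0 < z" "z \<le> 1" by auto
    have "[1, 1, z] \<in> ?I"
      using A(1) B(1) z unfolding memb by simp
    moreover have "coherent ?F [1, 1, z]" "coherent (?F @ [P given S]) ([1, 1, z] @ [z])"
      using coherent_witness[OF ind z] by simp_all
    ultimately show "z \<in> coherent_extensions ?F ?I (P given S)"
      unfolding coherent_extensions_def using z by force
  qed
  ultimately show ?thesis
    by (simp add: entails_s_def strictly_valid_def g_coherent_def greaterThanAtMost_subseteq_atLeastAtMost_iff)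
qed

theorem mainTheorem7:
  fixes S M P :: "'a::boolean_algebra"
  assumes "logically_independent3 S M P"
  shows
    \<comment> \<open>Darapti\<close>
    "([(P given M, {1}), (S given M, {1}), (M given sup S M, {0<..1})]
        \<Turnstile>\<^sub>s (P given S, {0<..1})) \<and>
    \<comment> \<open>Datisi\<close>
    ([(P given M, {1}), (S given M, {0<..1}), (M given sup S M, {0<..1})]
        \<Turnstile>\<^sub>s (P given S, {0<..1})) \<and>
    \<comment> \<open>Disamis\<close>
    ([(P given M, {0<..1}), (S given M, {1}), (M given sup S M, {0<..1})]
        \<Turnstile>\<^sub>s (P given S, {0<..1})) \<and>
    \<comment> \<open>Felapton\<close>
    ([(P given M, {0}), (S given M, {1}), (M given sup S M, {0<..1})]
        \<Turnstile>\<^sub>s (- P given S, {0<..1})) \<and>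
    \<comment> \<open>Ferison\<close>
    ([(P given M, {0}), (S given M, {0<..1}), (M given sup S M, {0<..1})]
        \<Turnstile>\<^sub>s (- P given S, {0<..1})) \<and>
    \<comment> \<open>Bocardo\<close>
    ([(- P given M, {0<..1}), (S given M, {1}), (M given sup S M, {0<..1})]
        \<Turnstile>\<^sub>s (- P given S, {0<..1}))"
proof -
  note affirmative = figure_III[OF assms]
  note negative = figure_III[OF logically_independent3_compl[OF assms]]
  show ?thesis
  proof (intro conjI)
    show "[(P given M, {0}), (S given M, {1}), (M given sup S M, {0<..1})]
        \<Turnstile>\<^sub>s (- P given S, {0<..1})"
      "[(P given M, {0}), (S given M, {0<..1}), (M given sup S M, {0<..1})]
        \<Turnstile>\<^sub>s (- P given S, {0<..1})"
      by (rule entails_s_negate; use negative in auto)+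
  qed (rule affirmative negative; simp)+
qed

end
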